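(* Let $n\ge 1$ be an integer and let $(X,\mu)$ be a finite measure space. For $1\le i\le n$, let $P_i=p_i\mu$ and $Q_i=q_i\mu$ be probability measures on $X$, absolutely continuous with respect to $\mu$, whose density functions $p_i$ and $q_i$ are nonzero $\mu$-a.e. Let $f_i:(0,\infty)\to\mathbb{R}^+$, $1\le i\le n$, be convex functions. Write $\vec{\mathbf f}=(f_1,\dots,f_n)$, $\vec{\mathbf P}=(P_1,\dots,P_n)$, $\vec{\mathbf Q}=(Q_1,\dots,Q_n)$. Then, for every integer $m$ with $1\le m\le n$, $$\big[D_{\vec{\mathbf f}}(\vec{\mathbf P},\vec{\mathbf Q})\big]^m\le \prod_{k=n-m+1}^{n} D_{\vec{\mathbf f}^{\,n,k}}\big(\vec{\mathbf P}^{\,n,k},\vec{\mathbf Q}^{\,n,k}\big).$$ Equality holds if and only if one of the functions $g_0^{1/m}g_i$, $1\le i\le m$, is null or all of them are effectively proportional $\mu$-a.e. If $m=n$, $$\big[D_{\vec{\mathbf f}}(\vec{\mathbf P},\vec{\mathbf Q})\big]^n\le\prod_{i=1}^n D_{f_i}(P_i,Q_i),$$ with equality if and only if one of the functions $f_j\left(\frac{p_j}{q_j}\right)q_j$, $1\le j\le n$, is null or all of them are effectively proportional $\mu$-a.e.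
   Context: $\mathbb{R}^+=\{x\in\mathbb{R}:x\ge 0\}$. Convention: $0\cdot\infty=0$. Mixed $f$-divergence: for $\vec{\mathbf f}=(f_1,\dots,f_n)$ and vectors of probability measures $\vec{\mathbf P}=(P_1,\dots,P_n)$, $\vec{\mathbf Q}=(Q_1,\dots,Q_n)$ with densities $p_i,q_i$ with respect to $\mu$, $$D_{\vec{\mathbf f}}(\vec{\mathbf P},\vec{\mathbf Q})=\int_X\prod_{i=1}^n\left[f_i\left(\frac{p_i}{q_i}\right)q_i\right]^{1/n}d\mu .$$ Classical $f$-divergence of one triple: $D_f(P,Q)=\int_X f\left(\frac pq\right)q\,d\mu$. For a fixed $m$ and for $k>n-m$, a vector $\vec v=(v_1,\dots,v_n)$ (of functions or of measures) gives the vector $\vec v^{\,n,k}=(v_1,\dots,v_{n-m},\underbrace{v_k,\dots,v_k}_{m})$. The functions $g_0,\dots,g_m$ on $X$ are $$g_0=\prod_{i=1}^{n-m}\left[f_i\left(\frac{p_i}{q_i}\right)q_i\right]^{1/n}\quad(\text{an empty product equals }1),\qquad g_{j+1}=\left[f_{n-j}\left(\frac{p_{n-j}}{q_{n-j}}\right)q_{n-j}\right]^{1/n},\quad j=0,\dots,m-1.$$ Two functions $f$ and $g$ are effectively proportional ($\mu$-a.e.) if there are constants $a,b$, not both zero, such that $af=bg$ ($\mu$-a.e.). Functions $h_1,\dots,h_r$ are effectively proportional if every pair $(h_i,h_j)$, $1\le i,j\le r$, is effectively proportional. A null function (zero $\mu$-a.e.) is effectively proportional to any function.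
   Formalization: The "only if" half of both equality characterizations is asserted only when the mixed f-divergence D is finite; for infinite D both sides are infinite and equality holds without proportionality. The inequalities and the "if" halves are unrestricted. *)

theory Defs
  imports "HOL-Probability.Probability"
begin

(* Divergences take values in [0, \<infinity>]: the integrands are nonnegative, the integrals may
   diverge, and in ennreal 0 * \<infinity> = 0, which is the convention of the paper.
   They are functions of measures; the densities are the Radon-Nikodym derivatives with
   respect to M. Independence of the chosen versions of the densities is
   mixed_f_divergence_density and f_divergence_density below. *)

definition rn_density :: "'a measure \<Rightarrow> 'a measure \<Rightarrow> 'a \<Rightarrow> real" where
  "rn_density M N x = enn2real (RN_deriv M N x)"

definition mixed_f_divergence ::
  "'a measure \<Rightarrow> nat \<Rightarrow> (nat \<Rightarrow> real \<Rightarrow> real) \<Rightarrow> (nat \<Rightarrow> 'a measure) \<Rightarrow> (nat \<Rightarrow> 'a measure) \<Rightarrow> ennreal" where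
  "mixed_f_divergence M n f P Q =
     (\<integral>\<^sup>+x. ennreal (\<Prod>i=1..n. (f i (rn_density M (P i) x / rn_density M (Q i) x)
                               * rn_density M (Q i) x) powr (1 / real n)) \<partial>M)"

definition f_divergence ::
  "'a measure \<Rightarrow> (real \<Rightarrow> real) \<Rightarrow> 'a measure \<Rightarrow> 'a measure \<Rightarrow> ennreal" where
  "f_divergence M f P Q =
     (\<integral>\<^sup>+x. ennreal (f (rn_density M P x / rn_density M Q x) * rn_density M Q x) \<partial>M)"

(* Vectors of length n are functions on nat of which only the values at 1, ..., n matter.
   This is (v_1, ..., v_(n-m), v_k, ..., v_k), with m copies of v_k. *)
definition repl_vec :: "nat \<Rightarrow> nat \<Rightarrow> nat \<Rightarrow> (nat \<Rightarrow> 'b) \<Rightarrow> nat \<Rightarrow> 'b" where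
  "repl_vec n m k v = (\<lambda>i. if i \<le> n - m then v i else v k)"

primrec g_fun ::
  "nat \<Rightarrow> nat \<Rightarrow> (nat \<Rightarrow> real \<Rightarrow> real) \<Rightarrow> (nat \<Rightarrow> 'a \<Rightarrow> real) \<Rightarrow> (nat \<Rightarrow> 'a \<Rightarrow> real) \<Rightarrow> nat \<Rightarrow> 'a \<Rightarrow> real" where
  "g_fun n m f p q 0 = (\<lambda>x. \<Prod>i=1..n-m. (f i (p i x / q i x) * q i x) powr (1 / real n))"
| "g_fun n m f p q (Suc j) =
     (\<lambda>x. (f (n - j) (p (n - j) x / q (n - j) x) * q (n - j) x) powr (1 / real n))"

definition null_function :: "'a measure \<Rightarrow> ('a \<Rightarrow> real) \<Rightarrow> bool" where
  "null_function M h \<longleftrightarrow> (AE x in M. h x = 0)"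

definition effectively_proportional :: "'a measure \<Rightarrow> ('a \<Rightarrow> real) \<Rightarrow> ('a \<Rightarrow> real) \<Rightarrow> bool" where
  "effectively_proportional M h1 h2 \<longleftrightarrow>
     (\<exists>a b :: real. \<not> (a = 0 \<and> b = 0) \<and> (AE x in M. a * h1 x = b * h2 x))"

definition all_effectively_proportional :: "'a measure \<Rightarrow> nat \<Rightarrow> (nat \<Rightarrow> 'a \<Rightarrow> real) \<Rightarrow> bool" where
  "all_effectively_proportional M r h \<longleftrightarrow>
     (\<forall>i\<in>{1..r}. \<forall>j\<in>{1..r}. effectively_proportional M (h i) (h j))"

lemma rn_density_AE:
  assumes "finite_measure M" "p \<in> borel_measurable M" "AE x in M. 0 \<le> p x"
    and "N = density M (\<lambda>x. ennreal (p x))"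
  shows "AE x in M. rn_density M N x = p x"
proof -
  interpret finite_measure M by fact
  have "AE x in M. ennreal (p x) = RN_deriv M N x"
    using assms(2,4) by (intro RN_deriv_unique) auto
  with assms(3) show ?thesis
    by eventually_elim (metis enn2real_ennreal rn_density_def)
qed

lemma f_divergence_density:
  assumes "finite_measure M"
    and "p \<in> borel_measurable M" "AE x in M. 0 \<le> p x" "P = density M (\<lambda>x. ennreal (p x))"
    and "q \<in> borel_measurable M" "AE x in M. 0 \<le> q x" "Q = density M (\<lambda>x. ennreal (q x))"
  shows "f_divergence M f P Q = (\<integral>\<^sup>+x. ennreal (f (p x / q x) * q x) \<partial>M)"
  unfolding f_divergence_def
  using rn_density_AE[OF assms(1-4)] rn_density_AE[OF assms(1,5-7)]
  by (intro nn_integral_cong_AE, eventually_elim) simp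

lemma mixed_f_divergence_density:
  assumes "finite_measure M"
    and "\<And>i. i \<in> {1..n} \<Longrightarrow> p i \<in> borel_measurable M"
    and "\<And>i. i \<in> {1..n} \<Longrightarrow> AE x in M. 0 \<le> p i x"
    and "\<And>i. i \<in> {1..n} \<Longrightarrow> P i = density M (\<lambda>x. ennreal (p i x))"
    and "\<And>i. i \<in> {1..n} \<Longrightarrow> q i \<in> borel_measurable M"
    and "\<And>i. i \<in> {1..n} \<Longrightarrow> AE x in M. 0 \<le> q i x"
    and "\<And>i. i \<in> {1..n} \<Longrightarrow> Q i = density M (\<lambda>x. ennreal (q i x))"
  shows "mixed_f_divergence M n f P Q =
    (\<integral>\<^sup>+x. ennreal (\<Prod>i=1..n. (f i (p i x / q i x) * q i x) powr (1 / real n)) \<partial>M)"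
proof -
  have P: "AE x in M. \<forall>i\<in>{1..n}. rn_density M (P i) x = p i x"
    using assms by (intro AE_finite_allI rn_density_AE) auto
  have Q: "AE x in M. \<forall>i\<in>{1..n}. rn_density M (Q i) x = q i x"
    using assms by (intro AE_finite_allI rn_density_AE) auto
  show ?thesis
    unfolding mixed_f_divergence_def using P Q
    by (intro nn_integral_cong_AE, eventually_elim) (auto intro!: arg_cong[where f = ennreal] prod.cong)
qed

end

theory Submission
  imports Defs
begin

text \<open>
  Write \<open>\<phi>\<^sub>i = f\<^sub>i (p\<^sub>i / q\<^sub>i) q\<^sub>i\<close>. Both inequalities are instances of Hoelder's
  inequality for \<open>m\<close> nonnegative functions with equal exponents,
    \<open>(\<integral> \<Prod>\<^sub>i w\<^sub>i)\<^sup>m \<le> \<Prod>\<^sub>i \<integral> w\<^sub>i\<^sup>m\<close>.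
  For the first one, \<open>w\<^sub>i = g\<^sub>0\<^sup>1\<^sup>/\<^sup>m g\<^sub>i\<close>: the \<open>m\<close> copies of \<open>g\<^sub>0\<^sup>1\<^sup>/\<^sup>m\<close> multiply up to \<open>g\<^sub>0\<close>, so that
  \<open>\<Prod>\<^sub>i w\<^sub>i\<close> is the integrand of the mixed divergence, and \<open>w\<^sub>i\<^sup>m = g\<^sub>0 g\<^sub>i\<^sup>m\<close> is the integrand in which the
  last \<open>m\<close> entries are all replaced by the one with index \<open>n + 1 - i\<close>. For the second one,
  \<open>w\<^sub>i = \<phi>\<^sub>i\<^sup>1\<^sup>/\<^sup>n\<close>; raising nonnegative functions to a positive power preserves nullity and
  proportionality, so the equality condition can be stated for the \<open>\<phi>\<^sub>i\<close>.

  Hoelder's inequality itself is the AM-GM inequality \<open>\<Prod>\<^sub>i v\<^sub>i \<le> (\<Sum>\<^sub>i v\<^sub>i\<^sup>m) / m\<close>, applied pointwise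
  to functions normalised by \<open>\<integral> v\<^sub>i\<^sup>m = 1\<close> and integrated. If the integrals agree, then AM-GM is an
  equality almost everywhere, which forces \<open>v\<^sub>i = v\<^sub>j\<close> almost everywhere: the original functions are
  proportional (lemma \<open>hoelder_equality_imp\<close>). The normalisation is possible when all
  \<open>\<integral> w\<^sub>i\<^sup>m\<close> are positive and finite. If one of them vanishes, both sides are \<open>0\<close>; if none vanishes
  and one is infinite, the right-hand side is infinite, and equality fails as soon as the left-hand
  side is finite.

  The integrands are measurable because a convex function on \<open>(0, \<infinity>)\<close> is continuous.
\<close>

section \<open>The AM-GM inequality with its equality case\<close>

text \<open>
  Divide by \<open>s\<close> and use \<open>t \<le> exp (t - 1)\<close>, which is strict unless \<open>t = 1\<close>: the product of the
  \<open>y\<^sub>i / s\<close> is at most the exponential of \<open>\<Sum>\<^sub>i (y\<^sub>i / s - 1) = 0\<close>.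
\<close>

lemma prod_less_mean_power:
  fixes y :: "'i \<Rightarrow> real"
  assumes "finite I" and nonneg: "\<And>i. i \<in> I \<Longrightarrow> 0 \<le> y i"
    and "0 < s" and mean: "(\<Sum>i\<in>I. y i) = real (card I) * s"
    and "k \<in> I" "y k \<noteq> s"
  shows "(\<Prod>i\<in>I. y i) < s ^ card I"
proof -
  have "(\<Prod>i\<in>I. y i / s) < (\<Prod>i\<in>I. exp (y i / s - 1))"
  proof (rule prod_mono_strict)
    show "k \<in> I" "finite I" by fact+
    show "y k / s < exp (y k / s - 1)"
      using exp_minus_greater[of "1 - y k / s"] \<open>y k \<noteq> s\<close> \<open>0 < s\<close> by simp
    show "0 \<le> y i / s \<and> y i / s \<le> exp (y i / s - 1)" if "i \<in> I" for i
      using nonneg[OF that] \<open>0 < s\<close> exp_ge_add_one_self[of "y i / s - 1"] by simp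
  qed simp
  also have "\<dots> = exp ((\<Sum>i\<in>I. y i) / s - real (card I))"
    using \<open>finite I\<close> by (simp add: exp_sum[symmetric] sum_subtractf sum_divide_distrib)
  also have "\<dots> = 1"
    using mean \<open>0 < s\<close> by simp
  finally show ?thesis
    using \<open>0 < s\<close> by (simp add: prod_dividef)
qed

text \<open>
  AM-GM for the numbers \<open>v\<^sub>i\<^sup>m\<close>, with \<open>m\<close> the number of factors, after taking \<open>m\<close>-th roots. With a
  product of the \<open>v\<^sub>i\<close> on the left it can be integrated as it stands. Either all \<open>v\<^sub>i\<^sup>m\<close> equal their
  mean, or the inequality is strict.
\<close>

lemma arith_geo_mean_powers:
  fixes v :: "'i \<Rightarrow> real"
  assumes "finite I" "I \<noteq> {}" and nonneg: "\<And>i. i \<in> I \<Longrightarrow> 0 \<le> v i"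
  shows arith_geo_mean_powers_le:
      "(\<Prod>i\<in>I. v i) \<le> (\<Sum>i\<in>I. v i ^ card I) / real (card I)"
    and arith_geo_mean_powers_eq:
      "(\<Prod>i\<in>I. v i) = (\<Sum>i\<in>I. v i ^ card I) / real (card I) \<Longrightarrow> i \<in> I \<Longrightarrow> j \<in> I \<Longrightarrow> v i = v j"
proof -
  define m where "m = card I"
  define s where "s = (\<Sum>i\<in>I. v i ^ m) / real m"
  have "0 < m" using assms by (simp add: m_def card_gt_0_iff)
  have "0 \<le> s" using nonneg by (auto simp: s_def intro!: divide_nonneg_nonneg sum_nonneg)
  have prod_power: "(\<Prod>i\<in>I. v i ^ m) = (\<Prod>i\<in>I. v i) ^ m"
    by (simp add: prod_power_distrib)
  have "(\<Prod>i\<in>I. v i) \<le> s \<and> ((\<Prod>i\<in>I. v i) = s \<longrightarrow> (\<forall>i\<in>I. \<forall>j\<in>I. v i = v j))"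
  proof (cases "\<forall>i\<in>I. v i ^ m = s")
    case True
    have "\<forall>i\<in>I. \<forall>j\<in>I. v i = v j"
      using True nonneg \<open>0 < m\<close> by (metis power_eq_imp_eq_base)
    moreover have "(\<Prod>i\<in>I. v i) ^ m = s ^ m"
      using True prod_power by (simp add: m_def)
    then have "(\<Prod>i\<in>I. v i) = s"
      by (rule power_eq_imp_eq_base) (fact | rule prod_nonneg nonneg)+
    ultimately show ?thesis by blast
  next
    case False
    then obtain k where k: "k \<in> I" "v k ^ m \<noteq> s" by auto
    have "s \<noteq> 0"
    proof
      assume "s = 0"
      then have "(\<Sum>i\<in>I. v i ^ m) = 0" using \<open>0 < m\<close> by (simp add: s_def)
      then have "\<forall>i\<in>I. v i ^ m = 0"
        using nonneg \<open>finite I\<close> by (subst (asm) sum_nonneg_eq_0_iff) auto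
      with k \<open>s = 0\<close> show False by simp
    qed
    then have "(\<Prod>i\<in>I. v i) ^ m < s ^ m"
      using prod_less_mean_power[of I "\<lambda>i. v i ^ m" s k] assms k \<open>0 \<le> s\<close> \<open>0 < m\<close>
      by (simp add: prod_power m_def[symmetric]) (simp add: s_def)
    then have "(\<Prod>i\<in>I. v i) < s"
      using \<open>0 \<le> s\<close> by (rule power_less_imp_less_base)
    then show ?thesis by simp
  qed
  then show "(\<Prod>i\<in>I. v i) \<le> (\<Sum>i\<in>I. v i ^ card I) / real (card I)"
    and "(\<Prod>i\<in>I. v i) = (\<Sum>i\<in>I. v i ^ card I) / real (card I) \<Longrightarrow> i \<in> I \<Longrightarrow> j \<in> I \<Longrightarrow> v i = v j"
    unfolding s_def m_def by blast+
qed


section \<open>Effective proportionality\<close>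

lemma null_function_cong_AE:
  assumes "AE x in M. u x = v x"
  shows "null_function M u \<longleftrightarrow> null_function M v"
  unfolding null_function_def
proof
  show "AE x in M. v x = 0" if "AE x in M. u x = 0"
    using that assms by eventually_elim simp
  show "AE x in M. u x = 0" if "AE x in M. v x = 0"
    using that assms by eventually_elim simp
qed

lemma effectively_proportional_cong_AE:
  assumes "AE x in M. u x = u' x" "AE x in M. v x = v' x"
  shows "effectively_proportional M u v \<longleftrightarrow> effectively_proportional M u' v'"
proof -
  have "(AE x in M. a * u x = b * v x) \<longleftrightarrow> (AE x in M. a * u' x = b * v' x)" for a b
  proof
    show "AE x in M. a * u' x = b * v' x" if "AE x in M. a * u x = b * v x"
      using that assms by eventually_elim simp
    show "AE x in M. a * u x = b * v x" if "AE x in M. a * u' x = b * v' x"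
      using that assms by eventually_elim simp
  qed
  then show ?thesis by (simp add: effectively_proportional_def)
qed

text \<open>
  The coefficient of \<open>u\<close> cannot vanish, since otherwise \<open>v\<close> would be null, and for nonnegative
  functions both coefficients may be replaced by their absolute values.
\<close>

lemma effectively_proportional_nonneg_multiple:
  assumes "effectively_proportional M u v" "\<not> null_function M v"
    and nonneg: "\<And>x. 0 \<le> u x" "\<And>x. 0 \<le> v x"
  obtains c where "0 \<le> c" "AE x in M. u x = c * v x"
proof -
  from assms(1) obtain a b where ab: "\<not> (a = 0 \<and> b = 0)" "AE x in M. a * u x = b * v x"
    by (auto simp: effectively_proportional_def)
  have "a \<noteq> 0"
    using ab assms(2) by (auto simp: null_function_def)
  have "AE x in M. u x = \<bar>b / a\<bar> * v x"
    using ab(2)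
  proof eventually_elim
    case (elim x)
    then have "\<bar>a\<bar> * u x = \<bar>b\<bar> * v x"
      using nonneg[of x] by (metis abs_mult abs_of_nonneg)
    then show ?case using \<open>a \<noteq> 0\<close> by (simp add: field_simps)
  qed
  then show thesis by (rule that[rotated]) simp
qed

lemma effectively_proportional_powr:
  assumes "effectively_proportional M u v"
    and nonneg: "\<And>x. 0 \<le> u x" "\<And>x. 0 \<le> v x"
  shows "effectively_proportional M (\<lambda>x. u x powr r) (\<lambda>x. v x powr r)"
proof -
  from assms(1) obtain a b where ab: "\<not> (a = 0 \<and> b = 0)" "AE x in M. a * u x = b * v x"
    by (auto simp: effectively_proportional_def)
  have "AE x in M. \<bar>a\<bar> powr r * u x powr r = \<bar>b\<bar> powr r * v x powr r"
    using ab(2)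
  proof eventually_elim
    case (elim x)
    then have "\<bar>a\<bar> * u x = \<bar>b\<bar> * v x"
      using nonneg[of x] by (metis abs_mult abs_of_nonneg)
    then show ?case
      using nonneg[of x] by (metis abs_ge_zero powr_mult)
  qed
  with ab(1) show ?thesis
    unfolding effectively_proportional_def
    by (intro exI[of _ "\<bar>a\<bar> powr r"] exI[of _ "\<bar>b\<bar> powr r"]) simp
qed

lemma effectively_proportional_powr_iff:
  assumes "r \<noteq> 0" and nonneg: "\<And>x. 0 \<le> u x" "\<And>x. 0 \<le> v x"
  shows "effectively_proportional M (\<lambda>x. u x powr r) (\<lambda>x. v x powr r) \<longleftrightarrow>
    effectively_proportional M u v"
  using effectively_proportional_powr[of M u v r]
    effectively_proportional_powr[of M "\<lambda>x. u x powr r" "\<lambda>x. v x powr r" "1 / r"] assms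
  by (auto simp: powr_powr)


section \<open>Hoelder's inequality for several functions with equal exponents\<close>

text \<open>
  Integrate AM-GM; its right-hand side \<open>S\<close> has integral \<open>1\<close>. If the left-hand side \<open>G\<close> has integral
  \<open>1\<close> as well, the nonnegative function \<open>S - G\<close> has integral \<open>0\<close>, so AM-GM is an equality almost
  everywhere.
\<close>

lemma hoelder_normalised:
  fixes v :: "'i \<Rightarrow> 'a \<Rightarrow> real"
  assumes I: "finite I" "I \<noteq> {}"
    and meas[measurable]: "\<And>i. i \<in> I \<Longrightarrow> v i \<in> borel_measurable M"
    and nonneg: "\<And>i x. i \<in> I \<Longrightarrow> 0 \<le> v i x"
    and norm: "\<And>i. i \<in> I \<Longrightarrow> (\<integral>\<^sup>+x. ennreal (v i x ^ card I) \<partial>M) = 1"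
  shows hoelder_normalised_le: "(\<integral>\<^sup>+x. ennreal (\<Prod>i\<in>I. v i x) \<partial>M) \<le> 1"
    and hoelder_normalised_eq: "(\<integral>\<^sup>+x. ennreal (\<Prod>i\<in>I. v i x) \<partial>M) = 1 \<Longrightarrow>
      AE x in M. \<forall>i\<in>I. \<forall>j\<in>I. v i x = v j x"
proof -
  define G where "G x = (\<Prod>i\<in>I. v i x)" for x
  define S where "S x = (\<Sum>i\<in>I. v i x ^ card I) / real (card I)" for x
  have G_meas[measurable]: "G \<in> borel_measurable M" and S_meas[measurable]: "S \<in> borel_measurable M"
    unfolding G_def S_def by measurable
  have "0 < card I" using I by (simp add: card_gt_0_iff)
  have "0 \<le> G x" for x using nonneg by (auto simp: G_def intro: prod_nonneg)
  have "G x \<le> S x" for x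
    unfolding G_def S_def using I nonneg by (rule arith_geo_mean_powers_le)
  have "(\<integral>\<^sup>+x. ennreal (S x) \<partial>M) = (\<integral>\<^sup>+x. (\<Sum>i\<in>I. ennreal (v i x ^ card I)) / ennreal (real (card I)) \<partial>M)"
    using nonneg \<open>0 < card I\<close>
    by (intro nn_integral_cong) (simp add: S_def divide_ennreal sum_nonneg)
  also have "\<dots> = (\<Sum>i\<in>I. (\<integral>\<^sup>+x. ennreal (v i x ^ card I) \<partial>M)) / ennreal (real (card I))"
    by (subst nn_integral_divide) (auto simp: nn_integral_sum)
  also have "\<dots> = ennreal (real (card I)) / ennreal (real (card I))"
    using norm by (simp add: ennreal_of_nat_eq_real_of_nat)
  also have "\<dots> = 1"
    using \<open>0 < card I\<close> by (simp add: divide_ennreal)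
  finally have S: "(\<integral>\<^sup>+x. ennreal (S x) \<partial>M) = 1" .
  have "(\<integral>\<^sup>+x. ennreal (G x) \<partial>M) \<le> 1"
    unfolding S[symmetric] using \<open>\<And>x. G x \<le> S x\<close> by (intro nn_integral_mono ennreal_leI)
  then show "(\<integral>\<^sup>+x. ennreal (\<Prod>i\<in>I. v i x) \<partial>M) \<le> 1" by (simp add: G_def)
  show "AE x in M. \<forall>i\<in>I. \<forall>j\<in>I. v i x = v j x" if "(\<integral>\<^sup>+x. ennreal (\<Prod>i\<in>I. v i x) \<partial>M) = 1"
  proof -
    have "(\<integral>\<^sup>+x. ennreal (S x) \<partial>M) = (\<integral>\<^sup>+x. ennreal (G x) + ennreal (S x - G x) \<partial>M)"
      using \<open>\<And>x. G x \<le> S x\<close> \<open>\<And>x. 0 \<le> G x\<close>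
      by (intro nn_integral_cong) (simp add: ennreal_plus[symmetric] del: ennreal_plus)
    also have "\<dots> = 1 + (\<integral>\<^sup>+x. ennreal (S x - G x) \<partial>M)"
      using that by (subst nn_integral_add) (auto simp: G_def[symmetric])
    finally have "1 + 0 = 1 + (\<integral>\<^sup>+x. ennreal (S x - G x) \<partial>M)"
      unfolding S by simp
    then have "(\<integral>\<^sup>+x. ennreal (S x - G x) \<partial>M) = 0"
      unfolding ennreal_add_left_cancel by simp
    then have "AE x in M. ennreal (S x - G x) = 0"
      by (subst (asm) nn_integral_0_iff_AE) auto
    then show ?thesis
    proof eventually_elim
      case (elim x)
      then have "G x = S x"
        using \<open>\<And>x. G x \<le> S x\<close>[of x] by (simp add: ennreal_eq_0_iff)
      then show ?case
        unfolding G_def S_def using I nonneg arith_geo_mean_powers_eq[of I "\<lambda>i. v i x"] by blast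
    qed
  qed
qed

context
  fixes M :: "'a measure" and I :: "'i set" and w :: "'i \<Rightarrow> 'a \<Rightarrow> real"
  assumes I: "finite I" "I \<noteq> {}"
    and meas[measurable]: "\<And>i. i \<in> I \<Longrightarrow> w i \<in> borel_measurable M"
    and nonneg: "\<And>i x. i \<in> I \<Longrightarrow> 0 \<le> w i x"
begin

private lemma card_pos: "0 < card I"
  using I by (simp add: card_gt_0_iff)

private lemma nn_integral_power_eq_0_iff:
  assumes "i \<in> I"
  shows "(\<integral>\<^sup>+x. ennreal (w i x ^ card I) \<partial>M) = 0 \<longleftrightarrow> null_function M (w i)"
proof -
  have "ennreal (w i x ^ card I) = 0 \<longleftrightarrow> w i x = 0" for x
    using nonneg[OF assms, of x] card_pos by (subst ennreal_eq_zero_iff) auto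
  then show ?thesis
    using assms by (subst nn_integral_0_iff_AE) (auto simp: null_function_def)
qed

private lemma nn_integral_prod_eq_0:
  assumes "i \<in> I" "null_function M (w i)"
  shows "(\<integral>\<^sup>+x. ennreal (\<Prod>i\<in>I. w i x) \<partial>M) = 0"
proof -
  have "AE x in M. ennreal (\<Prod>i\<in>I. w i x) = 0"
    using assms(2) unfolding null_function_def
  proof eventually_elim
    case (elim x)
    then have "(\<Prod>i\<in>I. w i x) = 0"
      using assms(1) I by (intro prod_zero) auto
    then show ?case by simp
  qed
  then show ?thesis by (subst nn_integral_0_iff_AE) auto
qed

text \<open>
  Dividing \<open>w\<^sub>i\<close> by the \<open>m\<close>-th root \<open>b\<^sub>i\<close> of \<open>\<integral> w\<^sub>i\<^sup>m\<close> normalises it, and both sides of Hoelder's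
  inequality scale by \<open>\<Prod>\<^sub>i b\<^sub>i\<^sup>m\<close>.
\<close>

private lemma hoelder_rescale:
  assumes pos: "\<And>i. i \<in> I \<Longrightarrow> (\<integral>\<^sup>+x. ennreal (w i x ^ card I) \<partial>M) \<noteq> 0"
    and fin: "\<And>i. i \<in> I \<Longrightarrow> (\<integral>\<^sup>+x. ennreal (w i x ^ card I) \<partial>M) \<noteq> \<infinity>"
  obtains b where "\<And>i. i \<in> I \<Longrightarrow> 0 < b i"
    and "\<And>i. i \<in> I \<Longrightarrow> (\<integral>\<^sup>+x. ennreal ((w i x / b i) ^ card I) \<partial>M) = 1"
    and "(\<integral>\<^sup>+x. ennreal (\<Prod>i\<in>I. w i x) \<partial>M) ^ card I =
      (\<Prod>i\<in>I. (\<integral>\<^sup>+x. ennreal (w i x ^ card I) \<partial>M)) * (\<integral>\<^sup>+x. ennreal (\<Prod>i\<in>I. w i x / b i) \<partial>M) ^ card I"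
proof -
  define A where "A i = (\<integral>\<^sup>+x. ennreal (w i x ^ card I) \<partial>M)" for i
  define b where "b i = root (card I) (enn2real (A i))" for i
  have A_pos: "0 < enn2real (A i)" if "i \<in> I" for i
    using pos[OF that] fin[OF that] by (simp add: A_def enn2real_positive_iff less_top[symmetric] zero_less_iff_neq_zero)
  have b_pos: "0 < b i" if "i \<in> I" for i
    using A_pos[OF that] card_pos by (simp add: b_def)
  have b_power: "ennreal (b i ^ card I) = A i" if "i \<in> I" for i
    using A_pos[OF that] card_pos fin[OF that] by (simp add: b_def A_def less_top[symmetric])
  have norm: "(\<integral>\<^sup>+x. ennreal ((w i x / b i) ^ card I) \<partial>M) = 1" if i: "i \<in> I" for i
  proof -
    have "(\<integral>\<^sup>+x. ennreal ((w i x / b i) ^ card I) \<partial>M) =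
        (\<integral>\<^sup>+x. ennreal (w i x ^ card I) / ennreal (b i ^ card I) \<partial>M)"
      using nonneg[OF i] b_pos[OF i] by (intro nn_integral_cong) (simp add: power_divide divide_ennreal)
    also have "\<dots> = A i / ennreal (b i ^ card I)"
      using i by (subst nn_integral_divide) (auto simp: A_def)
    also have "\<dots> = ennreal (b i ^ card I) / ennreal (b i ^ card I)"
      by (simp only: b_power[OF i])
    also have "\<dots> = 1"
      using b_pos[OF i] by (simp add: divide_ennreal)
    finally show ?thesis .
  qed
  have "(\<integral>\<^sup>+x. ennreal (\<Prod>i\<in>I. w i x) \<partial>M) =
      (\<integral>\<^sup>+x. ennreal (\<Prod>i\<in>I. b i) * ennreal (\<Prod>i\<in>I. w i x / b i) \<partial>M)"
  proof (intro nn_integral_cong)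
    fix x
    have "(\<Prod>i\<in>I. w i x) = (\<Prod>i\<in>I. b i) * (\<Prod>i\<in>I. w i x / b i)"
      unfolding prod.distrib[symmetric] using b_pos by (intro prod.cong) (auto simp: less_imp_neq[symmetric])
    then show "ennreal (\<Prod>i\<in>I. w i x) = ennreal (\<Prod>i\<in>I. b i) * ennreal (\<Prod>i\<in>I. w i x / b i)"
      using b_pos nonneg by (simp add: ennreal_mult prod_nonneg less_imp_le)
  qed
  also have "\<dots> = ennreal (\<Prod>i\<in>I. b i) * (\<integral>\<^sup>+x. ennreal (\<Prod>i\<in>I. w i x / b i) \<partial>M)"
    by (rule nn_integral_cmult) measurable
  finally have "(\<integral>\<^sup>+x. ennreal (\<Prod>i\<in>I. w i x) \<partial>M) ^ card I =
      ennreal (\<Prod>i\<in>I. b i) ^ card I * (\<integral>\<^sup>+x. ennreal (\<Prod>i\<in>I. w i x / b i) \<partial>M) ^ card I"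
    by (simp add: power_mult_distrib)
  moreover have "ennreal (\<Prod>i\<in>I. b i) ^ card I = (\<Prod>i\<in>I. A i)"
  proof -
    have "ennreal (\<Prod>i\<in>I. b i) ^ card I = ennreal (\<Prod>i\<in>I. b i ^ card I)"
      using b_pos by (simp add: ennreal_power prod_nonneg less_imp_le prod_power_distrib)
    also have "\<dots> = (\<Prod>i\<in>I. ennreal (b i ^ card I))"
      using b_pos by (intro prod_ennreal[symmetric]) (simp add: less_imp_le)
    also have "\<dots> = (\<Prod>i\<in>I. A i)"
      by (intro prod.cong) (simp_all add: b_power)
    finally show ?thesis .
  qed
  ultimately show thesis
    using b_pos norm by (intro that[of b]) (auto simp: A_def)
qed

lemma hoelder_le:
  "(\<integral>\<^sup>+x. ennreal (\<Prod>i\<in>I. w i x) \<partial>M) ^ card I \<le> (\<Prod>i\<in>I. (\<integral>\<^sup>+x. ennreal (w i x ^ card I) \<partial>M))"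
proof (cases "\<exists>i\<in>I. (\<integral>\<^sup>+x. ennreal (w i x ^ card I) \<partial>M) = 0")
  case True
  then show ?thesis
    using nn_integral_prod_eq_0 nn_integral_power_eq_0_iff card_pos by (auto simp: power_0_left)
next
  case pos: False
  show ?thesis
  proof (cases "\<exists>i\<in>I. (\<integral>\<^sup>+x. ennreal (w i x ^ card I) \<partial>M) = \<infinity>")
    case True
    with pos I have "(\<Prod>i\<in>I. (\<integral>\<^sup>+x. ennreal (w i x ^ card I) \<partial>M)) = \<infinity>"
      by (simp add: ennreal_prod_eq_top)
    then show ?thesis by simp
  next
    case False
    with pos obtain b where b: "\<And>i. i \<in> I \<Longrightarrow> 0 < b i"
      "\<And>i. i \<in> I \<Longrightarrow> (\<integral>\<^sup>+x. ennreal ((w i x / b i) ^ card I) \<partial>M) = 1"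
      "(\<integral>\<^sup>+x. ennreal (\<Prod>i\<in>I. w i x) \<partial>M) ^ card I =
      (\<Prod>i\<in>I. (\<integral>\<^sup>+x. ennreal (w i x ^ card I) \<partial>M)) * (\<integral>\<^sup>+x. ennreal (\<Prod>i\<in>I. w i x / b i) \<partial>M) ^ card I"
      using hoelder_rescale by blast
    have "(\<integral>\<^sup>+x. ennreal (\<Prod>i\<in>I. w i x / b i) \<partial>M) \<le> 1"
      using I nonneg b by (intro hoelder_normalised_le) (auto simp: less_imp_le)
    then have "(\<integral>\<^sup>+x. ennreal (\<Prod>i\<in>I. w i x / b i) \<partial>M) ^ card I \<le> 1"
      by (simp add: power_le_one)
    then show ?thesis
      unfolding b(3) using mult_left_mono by fastforce
  qed
qed

text \<open>
  Finiteness of the left-hand side cannot be dropped: if it is infinite, then so is the right-hand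
  side, and both agree for functions that need not be proportional. When it is finite and no factor
  on the right vanishes, equality makes all factors finite, so that the functions can be normalised.
\<close>

lemma hoelder_equality_imp:
  assumes fin: "(\<integral>\<^sup>+x. ennreal (\<Prod>i\<in>I. w i x) \<partial>M) < \<infinity>"
    and eq: "(\<integral>\<^sup>+x. ennreal (\<Prod>i\<in>I. w i x) \<partial>M) ^ card I =
      (\<Prod>i\<in>I. (\<integral>\<^sup>+x. ennreal (w i x ^ card I) \<partial>M))"
  shows "(\<exists>i\<in>I. null_function M (w i)) \<or> (\<forall>i\<in>I. \<forall>j\<in>I. effectively_proportional M (w i) (w j))"
proof (cases "\<exists>i\<in>I. (\<integral>\<^sup>+x. ennreal (w i x ^ card I) \<partial>M) = 0")
  case True
  then show ?thesis using nn_integral_power_eq_0_iff by auto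
next
  case pos: False
  define R where "R = (\<Prod>i\<in>I. (\<integral>\<^sup>+x. ennreal (w i x ^ card I) \<partial>M))"
  have "R \<noteq> 0" using pos I by (simp add: R_def)
  have "R \<noteq> \<infinity>"
    using fin eq card_pos unfolding R_def by (metis less_irrefl infinity_ennreal_def power_eq_top_ennreal)
  then have "\<forall>i\<in>I. (\<integral>\<^sup>+x. ennreal (w i x ^ card I) \<partial>M) \<noteq> \<infinity>"
    using pos I by (auto simp: ennreal_prod_eq_top R_def)
  with pos obtain b where b: "\<And>i. i \<in> I \<Longrightarrow> 0 < b i"
    "\<And>i. i \<in> I \<Longrightarrow> (\<integral>\<^sup>+x. ennreal ((w i x / b i) ^ card I) \<partial>M) = 1"
    "(\<integral>\<^sup>+x. ennreal (\<Prod>i\<in>I. w i x) \<partial>M) ^ card I =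
      R * (\<integral>\<^sup>+x. ennreal (\<Prod>i\<in>I. w i x / b i) \<partial>M) ^ card I"
    using hoelder_rescale unfolding R_def by blast
  define E where "E = (\<integral>\<^sup>+x. ennreal (\<Prod>i\<in>I. w i x / b i) \<partial>M)"
  have "R = R * E ^ card I"
    using b(3) eq by (simp add: R_def E_def)
  moreover have "E \<le> 1"
    using I nonneg b unfolding E_def by (intro hoelder_normalised_le) (auto simp: less_imp_le)
  moreover obtain r where "R = ennreal r" "0 < r"
    using \<open>R \<noteq> 0\<close> \<open>R \<noteq> \<infinity>\<close> by (cases R) (auto simp: ennreal_eq_0_iff not_le)
  ultimately have "E = 1"
    using card_pos power_eq_imp_eq_base[of _ "card I" "1::real"]
    by (cases E) (auto simp: ennreal_power ennreal_mult[symmetric] top_unique)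
  then have scaled: "AE x in M. \<forall>i\<in>I. \<forall>j\<in>I. w i x / b i = w j x / b j"
    using I nonneg b unfolding E_def
    by (intro hoelder_normalised_eq) (auto simp: less_imp_le)
  have "effectively_proportional M (w i) (w j)" if "i \<in> I" "j \<in> I" for i j
    unfolding effectively_proportional_def
  proof (intro exI conjI)
    show "\<not> (1 / b i = 0 \<and> 1 / b j = 0)"
      using b(1)[OF that(1)] by simp
    show "AE x in M. 1 / b i * w i x = 1 / b j * w j x"
      using scaled
    proof eventually_elim
      case (elim x)
      then have "w i x / b i = w j x / b j" using that by blast
      then show ?case by simp
    qed
  qed
  then show ?thesis by blast
qed

text \<open>
  If all functions are multiples \<open>c\<^sub>i w\<^sub>k\<close> of one of them, both sides are
  \<open>\<Prod>\<^sub>i c\<^sub>i\<^sup>m (\<integral> w\<^sub>k\<^sup>m)\<^sup>m\<close>, finite or not.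
\<close>

lemma hoelder_equality_if:
  assumes "(\<exists>i\<in>I. null_function M (w i)) \<or> (\<forall>i\<in>I. \<forall>j\<in>I. effectively_proportional M (w i) (w j))"
  shows "(\<integral>\<^sup>+x. ennreal (\<Prod>i\<in>I. w i x) \<partial>M) ^ card I = (\<Prod>i\<in>I. (\<integral>\<^sup>+x. ennreal (w i x ^ card I) \<partial>M))"
proof (cases "\<exists>i\<in>I. null_function M (w i)")
  case True
  then obtain i where i: "i \<in> I" "null_function M (w i)" by auto
  then have "(\<Prod>i\<in>I. (\<integral>\<^sup>+x. ennreal (w i x ^ card I) \<partial>M)) = 0"
    using I nn_integral_power_eq_0_iff by auto
  then show ?thesis
    using nn_integral_prod_eq_0[OF i] card_pos by (simp add: power_0_left)
next
  case False
  obtain k where k: "k \<in> I" using I by auto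
  define A where "A = (\<integral>\<^sup>+x. ennreal (w k x ^ card I) \<partial>M)"
  have "\<forall>i\<in>I. \<exists>c\<ge>0. AE x in M. w i x = c * w k x"
    using effectively_proportional_nonneg_multiple False assms k nonneg by metis
  then obtain c where c: "\<And>i. i \<in> I \<Longrightarrow> 0 \<le> c i" "\<And>i. i \<in> I \<Longrightarrow> AE x in M. w i x = c i * w k x"
    by metis
  have "AE x in M. \<forall>i\<in>I. w i x = c i * w k x"
    using I c by (intro AE_finite_allI)
  then have "AE x in M. ennreal (\<Prod>i\<in>I. w i x) = ennreal (\<Prod>i\<in>I. c i) * ennreal (w k x ^ card I)"
    by eventually_elim (simp add: prod.distrib ennreal_mult prod_nonneg c nonneg[OF k])
  then have "(\<integral>\<^sup>+x. ennreal (\<Prod>i\<in>I. w i x) \<partial>M) =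
      (\<integral>\<^sup>+x. ennreal (\<Prod>i\<in>I. c i) * ennreal (w k x ^ card I) \<partial>M)"
    by (rule nn_integral_cong_AE)
  also have "\<dots> = ennreal (\<Prod>i\<in>I. c i) * A"
    unfolding A_def using k by (intro nn_integral_cmult) measurable
  finally have lhs: "(\<integral>\<^sup>+x. ennreal (\<Prod>i\<in>I. w i x) \<partial>M) = ennreal (\<Prod>i\<in>I. c i) * A" .
  have rhs: "(\<integral>\<^sup>+x. ennreal (w i x ^ card I) \<partial>M) = ennreal (c i ^ card I) * A" if i: "i \<in> I" for i
  proof -
    have "AE x in M. ennreal (w i x ^ card I) = ennreal (c i ^ card I) * ennreal (w k x ^ card I)"
      using c(2)[OF i] by eventually_elim (simp add: power_mult_distrib ennreal_mult c(1)[OF i] nonneg[OF k])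
    then have "(\<integral>\<^sup>+x. ennreal (w i x ^ card I) \<partial>M) =
        (\<integral>\<^sup>+x. ennreal (c i ^ card I) * ennreal (w k x ^ card I) \<partial>M)"
      by (rule nn_integral_cong_AE)
    also have "\<dots> = ennreal (c i ^ card I) * A"
      unfolding A_def using k by (intro nn_integral_cmult) measurable
    finally show ?thesis .
  qed
  have "(\<Prod>i\<in>I. (\<integral>\<^sup>+x. ennreal (w i x ^ card I) \<partial>M)) = (\<Prod>i\<in>I. ennreal (c i ^ card I)) * A ^ card I"
    by (simp add: rhs prod.distrib)
  also have "(\<Prod>i\<in>I. ennreal (c i ^ card I)) = ennreal (\<Prod>i\<in>I. c i) ^ card I"
    using c(1) by (simp add: prod_ennreal ennreal_power prod_nonneg prod_power_distrib)
  finally show ?thesis by (simp add: lhs power_mult_distrib)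
qed

lemma hoelder_with_equality_case:
  "(\<integral>\<^sup>+x. ennreal (\<Prod>i\<in>I. w i x) \<partial>M) ^ card I \<le> (\<Prod>i\<in>I. (\<integral>\<^sup>+x. ennreal (w i x ^ card I) \<partial>M)) \<and>
   ((\<integral>\<^sup>+x. ennreal (\<Prod>i\<in>I. w i x) \<partial>M) < \<infinity> \<longrightarrow>
     ((\<integral>\<^sup>+x. ennreal (\<Prod>i\<in>I. w i x) \<partial>M) ^ card I =
        (\<Prod>i\<in>I. (\<integral>\<^sup>+x. ennreal (w i x ^ card I) \<partial>M)) \<longleftrightarrow>
      (\<exists>i\<in>I. null_function M (w i)) \<or> (\<forall>i\<in>I. \<forall>j\<in>I. effectively_proportional M (w i) (w j)))) \<and>
   ((\<exists>i\<in>I. null_function M (w i)) \<or> (\<forall>i\<in>I. \<forall>j\<in>I. effectively_proportional M (w i) (w j)) \<longrightarrow>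
     (\<integral>\<^sup>+x. ennreal (\<Prod>i\<in>I. w i x) \<partial>M) ^ card I =
       (\<Prod>i\<in>I. (\<integral>\<^sup>+x. ennreal (w i x ^ card I) \<partial>M)))"
  using hoelder_le hoelder_equality_imp hoelder_equality_if by blast

end


section \<open>The integrands of the divergences\<close>

text \<open>
  The perspective \<open>f (p / q) q\<close> of \<open>f\<close>, set to \<open>0\<close> off the set where both densities are positive.
  For densities that are positive almost everywhere this changes it on a null set only, and it
  makes the function nonnegative and measurable no matter what \<open>f\<close> does outside \<open>(0, \<infinity>)\<close>.
\<close>

definition perspective :: "(real \<Rightarrow> real) \<Rightarrow> ('a \<Rightarrow> real) \<Rightarrow> ('a \<Rightarrow> real) \<Rightarrow> 'a \<Rightarrow> real" where
  "perspective f p q x = (if 0 < p x \<and> 0 < q x then f (p x / q x) * q x else 0)"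

lemma perspective_nonneg:
  assumes "\<And>t. 0 < t \<Longrightarrow> 0 \<le> f t"
  shows "0 \<le> perspective f p q x"
  using assms by (simp add: perspective_def)

lemma borel_measurable_perspective:
  assumes "convex_on {0<..} f"
    and [measurable]: "p \<in> borel_measurable M" "q \<in> borel_measurable M"
  shows "perspective f p q \<in> borel_measurable M"
proof -
  have "continuous_on {0<..} f"
    using assms(1) by (intro convex_on_continuous) auto
  then have [measurable]: "(\<lambda>t. indicator {0<..} t * f t) \<in> borel_measurable borel"
    using borel_measurable_continuous_on_indicator[of "{0<..}" f] by simp
  have "(\<lambda>x. if 0 < p x \<and> 0 < q x
      then (\<lambda>t. indicator {0<..} t * f t) (p x / q x) * q x else 0) \<in> borel_measurable M"
    by measurable
  also have "(\<lambda>x. if 0 < p x \<and> 0 < q x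
      then (\<lambda>t. indicator {0<..} t * f t) (p x / q x) * q x else 0) = perspective f p q"
    by (auto simp: fun_eq_iff perspective_def)
  finally show ?thesis .
qed

lemma perspective_AE:
  assumes "AE x in M. 0 \<le> p x" "AE x in M. p x \<noteq> 0" "AE x in M. 0 \<le> q x" "AE x in M. q x \<noteq> 0"
  shows "AE x in M. f (p x / q x) * q x = perspective f p q x"
  using assms by eventually_elim (simp add: perspective_def)

lemma powr_root_power:
  fixes x :: real
  assumes "0 \<le> x" "0 < m"
  shows "(x powr (1 / real m)) ^ m = x"
  using assms by (cases "x = 0") (auto simp: powr_power)

lemma repl_vec_eq_reindex: "repl_vec n m k v = (\<lambda>i. v (if i \<le> n - m then i else k))"
  by (auto simp: repl_vec_def)


section \<open>The inequalities for mixed f-divergences\<close>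

theorem theorem3p1:
  fixes M :: "'a measure" and n :: nat
    and f :: "nat \<Rightarrow> real \<Rightarrow> real"
    and P Q :: "nat \<Rightarrow> 'a measure" and p q :: "nat \<Rightarrow> 'a \<Rightarrow> real"
  assumes n: "n \<ge> 1"
    and fin: "finite_measure M"
    and p_meas: "\<And>i. i \<in> {1..n} \<Longrightarrow> p i \<in> borel_measurable M"
    and q_meas: "\<And>i. i \<in> {1..n} \<Longrightarrow> q i \<in> borel_measurable M"
    and p_nonneg: "\<And>i. i \<in> {1..n} \<Longrightarrow> AE x in M. 0 \<le> p i x"
    and q_nonneg: "\<And>i. i \<in> {1..n} \<Longrightarrow> AE x in M. 0 \<le> q i x"
    and p_nonzero: "\<And>i. i \<in> {1..n} \<Longrightarrow> AE x in M. p i x \<noteq> 0"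
    and q_nonzero: "\<And>i. i \<in> {1..n} \<Longrightarrow> AE x in M. q i x \<noteq> 0"
    and P_dens: "\<And>i. i \<in> {1..n} \<Longrightarrow> P i = density M (\<lambda>x. ennreal (p i x))"
    and Q_dens: "\<And>i. i \<in> {1..n} \<Longrightarrow> Q i = density M (\<lambda>x. ennreal (q i x))"
    and P_prob: "\<And>i. i \<in> {1..n} \<Longrightarrow> prob_space (P i)"
    and Q_prob: "\<And>i. i \<in> {1..n} \<Longrightarrow> prob_space (Q i)"
    and f_convex: "\<And>i. i \<in> {1..n} \<Longrightarrow> convex_on {0<..} (f i)"
    and f_nonneg: "\<And>i t. i \<in> {1..n} \<Longrightarrow> 0 < t \<Longrightarrow> 0 \<le> f i t"
  shows
    "(\<forall>m. 1 \<le> m \<and> m \<le> n \<longrightarrow>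
       (let D = mixed_f_divergence M n f P Q;
            R = (\<Prod>k=n-m+1..n. mixed_f_divergence M n
                   (repl_vec n m k f) (repl_vec n m k P) (repl_vec n m k Q));
            h = (\<lambda>i x. g_fun n m f p q 0 x powr (1 / real m) * g_fun n m f p q i x);
            C = ((\<exists>i\<in>{1..m}. null_function M (h i)) \<or> all_effectively_proportional M m h)
        in D ^ m \<le> R \<and> (D < \<infinity> \<longrightarrow> (D ^ m = R \<longleftrightarrow> C)) \<and> (C \<longrightarrow> D ^ m = R)))
     \<and>
     (let D = mixed_f_divergence M n f P Q;
          R = (\<Prod>i=1..n. f_divergence M (f i) (P i) (Q i));
          h = (\<lambda>j x. f j (p j x / q j x) * q j x);
          C = ((\<exists>j\<in>{1..n}. null_function M (h j)) \<or> all_effectively_proportional M n h)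
      in D ^ n \<le> R \<and> (D < \<infinity> \<longrightarrow> (D ^ n = R \<longleftrightarrow> C)) \<and> (C \<longrightarrow> D ^ n = R))"
proof -
  define \<phi> where "\<phi> i = perspective (f i) (p i) (q i)" for i
  have \<phi>_nonneg: "0 \<le> \<phi> i x" if "i \<in> {1..n}" for i x
    unfolding \<phi>_def by (rule perspective_nonneg) (rule f_nonneg[OF that])
  have \<phi>_meas: "\<phi> i \<in> borel_measurable M" if "i \<in> {1..n}" for i
    unfolding \<phi>_def using f_convex[OF that] p_meas[OF that] q_meas[OF that]
    by (rule borel_measurable_perspective)
  have \<phi>_AE: "AE x in M. f i (p i x / q i x) * q i x = \<phi> i x" if "i \<in> {1..n}" for i
    unfolding \<phi>_def using p_nonneg p_nonzero q_nonneg q_nonzero that by (intro perspective_AE) auto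
  have \<phi>_AE_all: "AE x in M. \<forall>i\<in>{1..n}. f i (p i x / q i x) * q i x = \<phi> i x"
    using \<phi>_AE by (intro AE_finite_allI) auto

  \<comment> \<open>The reindexing \<open>\<sigma>\<close> covers the given vectors and those with repeated entries at once.\<close>
  have mixed: "mixed_f_divergence M n (\<lambda>i. f (\<sigma> i)) (\<lambda>i. P (\<sigma> i)) (\<lambda>i. Q (\<sigma> i)) =
      (\<integral>\<^sup>+x. ennreal (\<Prod>i=1..n. \<phi> (\<sigma> i) x powr (1 / real n)) \<partial>M)"
    if \<sigma>: "\<And>i. i \<in> {1..n} \<Longrightarrow> \<sigma> i \<in> {1..n}" for \<sigma>
  proof -
    have "mixed_f_divergence M n (\<lambda>i. f (\<sigma> i)) (\<lambda>i. P (\<sigma> i)) (\<lambda>i. Q (\<sigma> i)) =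
      (\<integral>\<^sup>+x. ennreal (\<Prod>i=1..n. (f (\<sigma> i) (p (\<sigma> i) x / q (\<sigma> i) x) * q (\<sigma> i) x) powr (1 / real n)) \<partial>M)"
      using \<sigma> p_meas q_meas p_nonneg q_nonneg P_dens Q_dens
      by (intro mixed_f_divergence_density[OF fin]) blast+
    also have "\<dots> = (\<integral>\<^sup>+x. ennreal (\<Prod>i=1..n. \<phi> (\<sigma> i) x powr (1 / real n)) \<partial>M)"
      using \<phi>_AE_all
      by (intro nn_integral_cong_AE, eventually_elim) (use \<sigma> in \<open>auto intro!: arg_cong[where f = ennreal] prod.cong\<close>)
    finally show ?thesis .
  qed
  have classical: "f_divergence M (f i) (P i) (Q i) = (\<integral>\<^sup>+x. ennreal (\<phi> i x) \<partial>M)" if i: "i \<in> {1..n}" for i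
  proof -
    have "f_divergence M (f i) (P i) (Q i) = (\<integral>\<^sup>+x. ennreal (f i (p i x / q i x) * q i x) \<partial>M)"
      using i p_meas q_meas p_nonneg q_nonneg P_dens Q_dens
      by (intro f_divergence_density[OF fin]) blast+
    also have "\<dots> = (\<integral>\<^sup>+x. ennreal (\<phi> i x) \<partial>M)"
      using \<phi>_AE[OF i] by (intro nn_integral_cong_AE, eventually_elim) simp
    finally show ?thesis .
  qed
  have D_eq: "mixed_f_divergence M n f P Q = (\<integral>\<^sup>+x. ennreal (\<Prod>i=1..n. \<phi> i x powr (1 / real n)) \<partial>M)"
    using mixed[of "\<lambda>i. i"] by simp

  have first: "let D = mixed_f_divergence M n f P Q;
            R = (\<Prod>k=n-m+1..n. mixed_f_divergence M n
                   (repl_vec n m k f) (repl_vec n m k P) (repl_vec n m k Q));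
            h = (\<lambda>i x. g_fun n m f p q 0 x powr (1 / real m) * g_fun n m f p q i x);
            C = ((\<exists>i\<in>{1..m}. null_function M (h i)) \<or> all_effectively_proportional M m h)
        in D ^ m \<le> R \<and> (D < \<infinity> \<longrightarrow> (D ^ m = R \<longleftrightarrow> C)) \<and> (C \<longrightarrow> D ^ m = R)"
    if m: "1 \<le> m" "m \<le> n" for m
  proof -
    define g0 where "g0 x = (\<Prod>i=1..n-m. \<phi> i x powr (1 / real n))" for x
    define w where "w i x = g0 x powr (1 / real m) * \<phi> (n + 1 - i) x powr (1 / real n)" for i x
    have g0_nonneg: "0 \<le> g0 x" for x by (auto simp: g0_def intro: prod_nonneg)
    \<comment> \<open>The \<open>m\<close> factors \<open>g0 powr (1 / m)\<close>, one in each \<open>w i\<close>, recombine to \<open>g0\<close>.\<close>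
    have g0_power: "(g0 x powr (1 / real m)) ^ m = g0 x" for x
      using g0_nonneg[of x] m by (intro powr_root_power) auto
    have w_nonneg: "0 \<le> w i x" for i x by (simp add: w_def)
    have split: "{1..n} = {1..n-m} \<union> {n-m+1..n}" using m by auto
    have prod_split: "(\<Prod>i=1..n. F i) = (\<Prod>i=1..n-m. F i) * (\<Prod>i=n-m+1..n. F i)" for F :: "nat \<Rightarrow> real"
      unfolding split by (rule prod.union_disjoint) auto
    \<comment> \<open>The functions \<open>g\<^sub>1, \<dots>, g\<^sub>m\<close> run through the indices \<open>n, \<dots>, n - m + 1\<close> downwards.\<close>
    have reverse: "(\<Prod>i=1..m. F (n + 1 - i)) = (\<Prod>k=n-m+1..n. F k)" for F :: "nat \<Rightarrow> 'b::comm_monoid_mult"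
      using m by (intro prod.reindex_bij_witness[of _ "\<lambda>k. n + 1 - k" "\<lambda>i. n + 1 - i"]) auto
    have w_meas: "w i \<in> borel_measurable M" if "i \<in> {1..m}" for i
    proof -
      have [measurable]: "\<phi> (n + 1 - i) \<in> borel_measurable M"
        using that m by (intro \<phi>_meas) auto
      have [measurable]: "\<phi> i \<in> borel_measurable M" if "i \<in> {1..n-m}" for i
        using that m by (intro \<phi>_meas) auto
      show ?thesis unfolding w_def g0_def by measurable
    qed
    have D: "mixed_f_divergence M n f P Q = (\<integral>\<^sup>+x. ennreal (\<Prod>i\<in>{1..m}. w i x) \<partial>M)"
      unfolding D_eq
    proof (intro nn_integral_cong arg_cong[where f = ennreal])
      fix x
      show "(\<Prod>i=1..n. \<phi> i x powr (1 / real n)) = (\<Prod>i\<in>{1..m}. w i x)"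
        unfolding w_def prod.distrib prod_split reverse[of "\<lambda>i. \<phi> i x powr (1 / real n)"] g0_def[symmetric]
        by (simp add: g0_power)
    qed
    have R: "(\<Prod>k=n-m+1..n. mixed_f_divergence M n
        (repl_vec n m k f) (repl_vec n m k P) (repl_vec n m k Q)) =
        (\<Prod>i\<in>{1..m}. (\<integral>\<^sup>+x. ennreal (w i x ^ m) \<partial>M))"
      unfolding reverse[symmetric]
    proof (rule prod.cong[OF refl])
      fix i assume i: "i \<in> {1..m}"
      show "mixed_f_divergence M n (repl_vec n m (n + 1 - i) f) (repl_vec n m (n + 1 - i) P)
          (repl_vec n m (n + 1 - i) Q) = (\<integral>\<^sup>+x. ennreal (w i x ^ m) \<partial>M)"
        unfolding repl_vec_eq_reindex
      proof (subst mixed)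
        show "(if j \<le> n - m then j else n + 1 - i) \<in> {1..n}" if "j \<in> {1..n}" for j
          using that i m by auto
        show "(\<integral>\<^sup>+x. ennreal (\<Prod>j=1..n. \<phi> (if j \<le> n - m then j else n + 1 - i) x powr (1 / real n)) \<partial>M) =
            (\<integral>\<^sup>+x. ennreal (w i x ^ m) \<partial>M)"
        proof (intro nn_integral_cong arg_cong[where f = ennreal])
          fix x
          show "(\<Prod>j=1..n. \<phi> (if j \<le> n - m then j else n + 1 - i) x powr (1 / real n)) = w i x ^ m"
          proof -
            have "(\<Prod>j=1..n-m. \<phi> (if j \<le> n - m then j else n + 1 - i) x powr (1 / real n)) = g0 x"
              unfolding g0_def by (intro prod.cong) auto
            moreover have "(\<Prod>j=n-m+1..n. \<phi> (if j \<le> n - m then j else n + 1 - i) x powr (1 / real n)) =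
                (\<phi> (n + 1 - i) x powr (1 / real n)) ^ m"
              using m by simp
            ultimately show ?thesis
              unfolding prod_split by (simp add: w_def power_mult_distrib g0_power)
          qed
        qed
      qed
    qed
    define h where "h i x = g_fun n m f p q 0 x powr (1 / real m) * g_fun n m f p q i x" for i x
    have h_AE: "AE x in M. h i x = w i x" if i: "i \<in> {1..m}" for i
      using \<phi>_AE_all
    proof eventually_elim
      case (elim x)
      obtain j where j: "i = Suc j" using i by (cases i) auto
      have "g_fun n m f p q 0 x = g0 x"
        using elim by (auto simp: g0_def intro!: prod.cong)
      moreover have "g_fun n m f p q i x = \<phi> (n + 1 - i) x powr (1 / real n)"
        using elim i m by (simp add: j)
      ultimately show ?case by (simp add: h_def w_def)
    qed
    have C: "((\<exists>i\<in>{1..m}. null_function M (h i)) \<or> all_effectively_proportional M m h) \<longleftrightarrow>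
        ((\<exists>i\<in>{1..m}. null_function M (w i)) \<or>
         (\<forall>i\<in>{1..m}. \<forall>j\<in>{1..m}. effectively_proportional M (w i) (w j)))"
      unfolding all_effectively_proportional_def
      using null_function_cong_AE[OF h_AE] effectively_proportional_cong_AE[OF h_AE h_AE] by auto
    have "finite {1..m}" "{1..m} \<noteq> {}" using m by auto
    note hoelder_assms = this w_meas w_nonneg
    have card: "card {1..m} = m" by simp
    show ?thesis
      unfolding Let_def h_def[symmetric] C D R
      by (rule hoelder_with_equality_case[of "{1..m}" w M, unfolded card]) (rule hoelder_assms | assumption)+
  qed

  have second: "let D = mixed_f_divergence M n f P Q;
          R = (\<Prod>i=1..n. f_divergence M (f i) (P i) (Q i));
          h = (\<lambda>j x. f j (p j x / q j x) * q j x);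
          C = ((\<exists>j\<in>{1..n}. null_function M (h j)) \<or> all_effectively_proportional M n h)
      in D ^ n \<le> R \<and> (D < \<infinity> \<longrightarrow> (D ^ n = R \<longleftrightarrow> C)) \<and> (C \<longrightarrow> D ^ n = R)"
  proof -
    define w where "w i x = \<phi> i x powr (1 / real n)" for i x
    have w_nonneg: "0 \<le> w i x" for i x by (simp add: w_def)
    have w_meas: "w i \<in> borel_measurable M" if "i \<in> {1..n}" for i
      using \<phi>_meas[OF that] unfolding w_def by measurable
    have D: "mixed_f_divergence M n f P Q = (\<integral>\<^sup>+x. ennreal (\<Prod>i\<in>{1..n}. w i x) \<partial>M)"
      by (simp add: D_eq w_def)
    have "w i x ^ n = \<phi> i x" if "i \<in> {1..n}" for i x
      using \<phi>_nonneg[OF that, of x] n unfolding w_def by (intro powr_root_power) auto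
    then have R: "(\<Prod>i=1..n. f_divergence M (f i) (P i) (Q i)) =
        (\<Prod>i\<in>{1..n}. (\<integral>\<^sup>+x. ennreal (w i x ^ n) \<partial>M))"
      using classical by (intro prod.cong) auto
    define h where "h j x = f j (p j x / q j x) * q j x" for j x
    have h_AE: "AE x in M. h i x = \<phi> i x" if "i \<in> {1..n}" for i
      using \<phi>_AE[OF that] by (simp add: h_def)
    have null: "null_function M (h i) \<longleftrightarrow> null_function M (w i)" if "i \<in> {1..n}" for i
      using null_function_cong_AE[OF h_AE[OF that]] n by (simp add: null_function_def w_def)
    have proportional: "effectively_proportional M (h i) (h j) \<longleftrightarrow> effectively_proportional M (w i) (w j)"
      if "i \<in> {1..n}" "j \<in> {1..n}" for i j
      using effectively_proportional_cong_AE[OF h_AE[OF that(1)] h_AE[OF that(2)]] n \<phi>_nonneg that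
        effectively_proportional_powr_iff[of "1 / real n" "\<phi> i" "\<phi> j" M]
      by (simp add: w_def[abs_def])
    have C: "((\<exists>j\<in>{1..n}. null_function M (h j)) \<or> all_effectively_proportional M n h) \<longleftrightarrow>
        ((\<exists>i\<in>{1..n}. null_function M (w i)) \<or>
         (\<forall>i\<in>{1..n}. \<forall>j\<in>{1..n}. effectively_proportional M (w i) (w j)))"
      unfolding all_effectively_proportional_def using null proportional by auto
    have "finite {1..n}" "{1..n} \<noteq> {}" using n by auto
    note hoelder_assms = this w_meas w_nonneg
    have card: "card {1..n} = n" by simp
    show ?thesis
      unfolding Let_def h_def[symmetric] C D R
      by (rule hoelder_with_equality_case[of "{1..n}" w M, unfolded card]) (rule hoelder_assms | assumption)+
  qed
  show ?thesis using first second by blast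
qed

end
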